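(* Let $h$ be a continuous function on $\mathbb{R}$ in the Wiener amalgam space $\mathcal{W}_1$, and let $\omega$ be a positive increasing function on $(0,1)$ with $\lim_{\delta\to0}\omega(\delta)=0$. Let $\Phi=\{\phi_j\}_{j\in\mathbb{Z}}$ be a family of functions on $\mathbb{R}$ such that $$|\phi_j(x)|\le h(x-j)\quad\text{for all }x\in\mathbb{R},\ j\in\mathbb{Z},$$ and $$|\omega_\delta(\phi_j)(x)|\le\omega(\delta)\,h(x-j)\quad\text{for all }x\in\mathbb{R},\ j\in\mathbb{Z}\text{ and }\delta\in(0,1).$$ Let $S_\Phi$ be the synthesis operator associated with $\Phi$. If $S_\Phi$ has $\ell^p$-stability for some $1\le p\le\infty$, then it has $\ell^q$-stability for all $1\le q\le\infty$.
   Context: The modulus of continuity of a function $f$ on $\mathbb{R}$ is $\omega_\delta(f)(x)=\sup_{|y|\le\delta}|f(x+y)-f(x)|$. The Wiener amalgam space is $\mathcal{W}_1=\{\phi:\ \|\phi\|_{\mathcal{W}_1}:=\sum_{k\in\mathbb{Z}}\sup_{x\in[0,1)}|\phi(k+x)|<\infty\}$. The synthesis operator associated with $\Phi$ is $S_\Phi:\ \ell^p\ni(c(j))_{j\in\mathbb{Z}}\mapsto\sum_{j\in\mathbb{Z}}c(j)\phi_j\in L^p$, where $\ell^p=\ell^p(\mathbb{Z})$ and $L^p=L^p(\mathbb{R})$ carry their standard norms $\|\cdot\|_{\ell^p}$ and $\|\cdot\|_p$. $S_\Phi$ has $\ell^p$-stability if there exists a positive constant $C$ such that $C^{-1}\|c\|_{\ell^p}\le\|S_\Phi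 c\|_p\le C\|c\|_{\ell^p}$ for all $c\in\ell^p$. *)

theory Defs
  imports "HOL-Analysis.Analysis" "HOL-Probability.Essential_Supremum"
begin

text \<open>The suprema below are taken in \<^typ>\<open>ennreal\<close>, so they are meaningful (possibly infinite)
  for every function.\<close>

definition modulus_of_continuity :: "real \<Rightarrow> (real \<Rightarrow> 'a::real_normed_vector) \<Rightarrow> real \<Rightarrow> ennreal" where
  "modulus_of_continuity \<delta> f x = (SUP y\<in>{y. \<bar>y\<bar> \<le> \<delta>}. ennreal (norm (f (x + y) - f x)))"

definition wiener_norm :: "(real \<Rightarrow> 'a::real_normed_vector) \<Rightarrow> ennreal" where
  "wiener_norm f = (\<Sum>\<^sub>\<infinity>k::int. SUP x\<in>{0..<1}. ennreal (norm (f (of_int k + x))))"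

definition wiener_amalgam :: "(real \<Rightarrow> 'a::real_normed_vector) set" where
  "wiener_amalgam = {f. wiener_norm f < \<infinity>}"

text \<open>Exponents range over \<^typ>\<open>ennreal\<close>; only \<open>1 \<le> p \<le> \<infinity>\<close> is of interest.
  The norms are real-valued and only meaningful on the corresponding spaces.\<close>

definition lp_space :: "ennreal \<Rightarrow> (int \<Rightarrow> complex) set" where
  "lp_space p = {c. if p = \<infinity> then bounded (range c)
     else (\<lambda>j. norm (c j) powr enn2real p) summable_on UNIV}"

definition lp_norm :: "ennreal \<Rightarrow> (int \<Rightarrow> complex) \<Rightarrow> real" where
  "lp_norm p c = (if p = \<infinity> then (SUP j. norm (c j))
     else (\<Sum>\<^sub>\<infinity>j. norm (c j) powr enn2real p) powr (1 / enn2real p))"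

text \<open>Elements of \<open>L\<^sup>p(\<real>)\<close> are represented by functions rather than by classes modulo null sets.\<close>

definition Lp_space :: "ennreal \<Rightarrow> (real \<Rightarrow> complex) set" where
  "Lp_space p = {f \<in> borel_measurable lborel.
     if p = \<infinity> then esssup lborel (\<lambda>x. ennreal (norm (f x))) < \<infinity>
     else integrable lborel (\<lambda>x. norm (f x) powr enn2real p)}"

definition Lp_norm :: "ennreal \<Rightarrow> (real \<Rightarrow> complex) \<Rightarrow> real" where
  "Lp_norm p f = (if p = \<infinity> then enn2real (esssup lborel (\<lambda>x. ennreal (norm (f x))))
     else (LINT x|lborel. norm (f x) powr enn2real p) powr (1 / enn2real p))"

text \<open>The synthesis series is read pointwise. If \<open>\<bar>\<phi>\<^sub>j(x)\<bar> \<le> h(x - j)\<close> with \<open>h\<close> in the Wiener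
  amalgam space, it converges absolutely at every point for every bounded \<open>c\<close>; for \<open>p = \<infinity>\<close> it
  need not converge in \<open>L\<^sup>p\<close>-norm.\<close>

definition synthesis :: "(int \<Rightarrow> real \<Rightarrow> complex) \<Rightarrow> (int \<Rightarrow> complex) \<Rightarrow> real \<Rightarrow> complex" where
  "synthesis \<phi> c x = (\<Sum>\<^sub>\<infinity>j. c j * \<phi> j x)"

definition lp_stable :: "(int \<Rightarrow> real \<Rightarrow> complex) \<Rightarrow> ennreal \<Rightarrow> bool" where
  "lp_stable \<phi> p \<longleftrightarrow> (\<exists>C>0. \<forall>c\<in>lp_space p.
     synthesis \<phi> c \<in> Lp_space p \<and>
     inverse C * lp_norm p c \<le> Lp_norm p (synthesis \<phi> c) \<and>
     Lp_norm p (synthesis \<phi> c) \<le> C * lp_norm p c)"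

end

theory Submission
  imports Defs
begin

text \<open>Only \<open>H k = sup {h x | k \<le> x < k + 1}\<close>, a summable sequence, enters the argument. Test the
  \<open>\<ell>\<^sup>p\<close>-stability on \<open>w(\<sqdot> - n) c\<close> with \<open>w k = exp (- \<mu> \<bar>k\<bar>)\<close>. Since
  \<open>\<bar>w(i - n) - w(j - n)\<bar> \<le> (1 - exp (- \<mu> \<bar>i - j\<bar>)) (w(i - n) + w(j - n))\<close>, the commutator of the
  synthesis operator with this weight is dominated by convolution with
  \<open>K k = H k (1 - exp (- \<mu> \<bar>k\<bar>))\<close>, whose sum tends to \<open>0\<close> with \<open>\<mu>\<close>. The modulus of continuity
  bounds \<open>F = S\<^sub>\<Phi> c\<close> pointwise by its mean over an interval of length \<open>d\<close> plus a small multiple of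
  \<open>H * \<bar>c\<bar>\<close>. With \<open>\<beta> n = \<parallel>w(\<sqdot> - n) c\<parallel>\<^sub>p\<close> and \<open>g i\<close> the integral of \<open>\<bar>F\<bar>\<close> over \<open>[i, i + 1]\<close>,
  and because translating \<open>c\<close> under the weight amounts to translating \<open>\<beta>\<close>, this gives
  \<open>\<beta> \<le> A (w * g) + L * \<beta>\<close> up to a shift of \<open>g\<close>, with the sum of \<open>L\<close> at most \<open>1/2\<close>. In this
  inequality between sequences the exponent \<open>p\<close> no longer appears, so one may take
  \<open>\<ell>\<^sup>q\<close> norms, absorb \<open>L * \<beta>\<close>, and conclude from \<open>\<bar>c n\<bar> \<le> \<beta> n\<close> and \<open>\<parallel>g\<parallel>\<^sub>q \<le> \<parallel>F\<parallel>\<^sub>q\<close>.\<close>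

subsection \<open>Norm bounds for sequences\<close>

text \<open>Membership in \<open>\<ell>\<^sup>p\<close> and the bound on the norm in a single predicate: bounding finite partial sums
  avoids separate summability side conditions.\<close>

definition lp_le :: "ennreal \<Rightarrow> (int \<Rightarrow> real) \<Rightarrow> real \<Rightarrow> bool" where
  "lp_le p u t \<longleftrightarrow> 0 \<le> t \<and> (\<forall>i. 0 \<le> u i) \<and>
     (if p = \<infinity> then \<forall>i. u i \<le> t
      else \<forall>F. finite F \<longrightarrow> (\<Sum>i\<in>F. u i powr enn2real p) \<le> t powr enn2real p)"

lemma enn2real_ge_1: "1 \<le> p \<Longrightarrow> p \<noteq> \<infinity> \<Longrightarrow> 1 \<le> enn2real p"
  by (metis enn2real_1 enn2real_mono infinity_ennreal_def order_less_le top_greatest)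

lemma lp_le_nonneg: "lp_le p u t \<Longrightarrow> 0 \<le> t" and lp_le_nonneg': "lp_le p u t \<Longrightarrow> 0 \<le> u i"
  by (auto simp: lp_le_def)

lemma lp_le_mono:
  assumes "lp_le p v t" "\<And>i. 0 \<le> u i" "\<And>i. u i \<le> v i" "t \<le> s" "1 \<le> p"
  shows "lp_le p u s"
proof (cases "p = \<infinity>")
  case True
  have "u i \<le> s" for i
    using assms(1,3,4) True by (force simp: lp_le_def intro: order_trans)
  then show ?thesis using True assms lp_le_nonneg[OF assms(1)] by (auto simp: lp_le_def)
next
  case False
  then have r: "1 \<le> enn2real p" using assms(5) by (rule enn2real_ge_1[rotated])
  have "(\<Sum>i\<in>F. u i powr enn2real p) \<le> s powr enn2real p" if "finite F" for F
  proof -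
    have "(\<Sum>i\<in>F. u i powr enn2real p) \<le> (\<Sum>i\<in>F. v i powr enn2real p)"
      using r assms by (intro sum_mono powr_mono2) auto
    also have "\<dots> \<le> t powr enn2real p" using assms(1) False that by (auto simp: lp_le_def)
    also have "\<dots> \<le> s powr enn2real p"
      using r assms(4) lp_le_nonneg[OF assms(1)] by (intro powr_mono2) auto
    finally show ?thesis .
  qed
  then show ?thesis using False assms lp_le_nonneg[OF assms(1)] by (auto simp: lp_le_def)
qed

lemma lp_le_bound:
  assumes "lp_le p u t" "1 \<le> p"
  shows "u i \<le> t"
proof (cases "p = \<infinity>")
  case False
  then have r: "1 \<le> enn2real p" using assms(2) by (rule enn2real_ge_1[rotated])
  have "(\<Sum>i\<in>{i}. u i powr enn2real p) \<le> t powr enn2real p"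
    using assms(1) False unfolding lp_le_def by (metis finite.emptyI finite_insert)
  then show ?thesis
    using r lp_le_nonneg[OF assms(1)] lp_le_nonneg'[OF assms(1)]
    by (simp add: powr_mono_both) (smt (verit) powr_less_mono2)
qed (use assms in \<open>auto simp: lp_le_def\<close>)

lemma lp_le_shift:
  assumes "lp_le p u t"
  shows "lp_le p (\<lambda>i. u (i + k)) t"
proof (cases "p = \<infinity>")
  case False
  have "(\<Sum>i\<in>F. u (i + k) powr enn2real p) \<le> t powr enn2real p" if "finite F" for F
  proof -
    have "(\<Sum>i\<in>F. u (i + k) powr enn2real p) = (\<Sum>i\<in>(\<lambda>i. i + k) ` F. u i powr enn2real p)"
      by (subst sum.reindex) (auto simp: inj_on_def)
    then show ?thesis using assms False that by (auto simp: lp_le_def)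
  qed
  then show ?thesis using assms False by (auto simp: lp_le_def)
qed (use assms in \<open>auto simp: lp_le_def\<close>)

lemma lp_le_cmult:
  assumes "lp_le p u t" "0 \<le> a"
  shows "lp_le p (\<lambda>i. a * u i) (a * t)"
  using assms by (auto simp: lp_le_def powr_mult simp flip: sum_distrib_left intro!: mult_left_mono)

lemma lp_le_zero: "lp_le p (\<lambda>_. 0) 0"
  by (auto simp: lp_le_def)

text \<open>Convexity on the open half-line is known. A segment with an endpoint at 0 needs only
  \<open>s powr r \<le> s\<close> for \<open>s\<close> in [0,1].\<close>

lemma convex_on_powr_nonneg:
  assumes "1 \<le> (r :: real)"
  shows "convex_on {0..} (\<lambda>x. x powr r)"
proof (rule convex_onI)
  fix t x y :: real
  assume *: "0 < t" "t < 1" "x \<in> {0..}" "y \<in> {0..}"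
  have le: "s powr r \<le> s" if "0 \<le> s" "s \<le> 1" for s :: real
    using powr_mono'[of 1 r s] that assms by auto
  consider "x = 0" | "y = 0" | "0 < x" "0 < y" using * by force
  then show "((1 - t) *\<^sub>R x + t *\<^sub>R y) powr r \<le> (1 - t) * x powr r + t * y powr r"
  proof cases
    case 1
    then show ?thesis using * le[of t] assms by (simp add: powr_mult mult_right_mono)
  next
    case 2
    then show ?thesis using * le[of "1 - t"] assms by (simp add: powr_mult mult_right_mono)
  next
    case 3
    then show ?thesis
      using convex_onD[OF powr_convex[OF assms], of t x y] * by auto
  qed
qed simp

text \<open>Minkowski's inequality by convexity: (u + v)/(s + t) is the convex combination of u/s
  and v/t with weights s/(s + t) and t/(s + t), and the r-th powers of u/s and v/t sum to at most 1.
  If \<open>s\<close> or \<open>t\<close> is 0, the corresponding sequence vanishes.\<close>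

lemma lp_le_add:
  assumes u: "lp_le p u s" and v: "lp_le p v t" and p: "1 \<le> p"
  shows "lp_le p (\<lambda>i. u i + v i) (s + t)"
proof (cases "p = \<infinity>")
  case True
  then show ?thesis using u v by (auto simp: lp_le_def intro: add_mono)
next
  case False
  define r where "r = enn2real p"
  have r: "1 \<le> r" unfolding r_def using p False by (rule enn2real_ge_1)
  note nn = lp_le_nonneg[OF u] lp_le_nonneg[OF v] lp_le_nonneg'[OF u] lp_le_nonneg'[OF v]
  consider "s = 0" | "t = 0" | "0 < s" "0 < t" using nn by force
  then show ?thesis
  proof cases
    case 1
    then have "u i = 0" for i using lp_le_bound[OF u p] nn by (simp add: order_antisym)
    then show ?thesis using 1 v by simp
  next
    case 2
    then have "v i = 0" for i using lp_le_bound[OF v p] nn by (simp add: order_antisym)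
    then show ?thesis using 2 u by simp
  next
    case 3
    have "(\<Sum>i\<in>F. (u i + v i) powr r) \<le> (s + t) powr r" if F: "finite F" for F
    proof -
      have *: "((u i + v i) / (s + t)) powr r
          \<le> s / (s + t) * (u i powr r / s powr r) + t / (s + t) * (v i powr r / t powr r)" for i
      proof -
        have 1: "1 - t / (s + t) = s / (s + t)" using 3 by (simp add: field_simps)
        have "(u i + v i) / (s + t) = (1 - t / (s + t)) *\<^sub>R (u i / s) + (t / (s + t)) *\<^sub>R (v i / t)"
          unfolding 1 using 3 by (simp add: add_divide_distrib)
        also have "\<dots> powr r \<le> (1 - t / (s + t)) * (u i / s) powr r + (t / (s + t)) * (v i / t) powr r"
          using 3 nn by (intro convex_onD[OF convex_on_powr_nonneg[OF r]]) auto
        finally show ?thesis unfolding 1 using 3 nn by (simp add: powr_divide)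
      qed
      have "(\<Sum>i\<in>F. ((u i + v i) / (s + t)) powr r)
          \<le> (\<Sum>i\<in>F. s / (s + t) * (u i powr r / s powr r) + t / (s + t) * (v i powr r / t powr r))"
        by (intro sum_mono *)
      also have "\<dots> = s / (s + t) * ((\<Sum>i\<in>F. u i powr r) / s powr r)
                    + t / (s + t) * ((\<Sum>i\<in>F. v i powr r) / t powr r)"
        by (simp add: sum.distrib sum_distrib_left sum_divide_distrib)
      also have "\<dots> \<le> s / (s + t) * 1 + t / (s + t) * 1"
        using u v F 3 False by (intro add_mono mult_left_mono) (auto simp: lp_le_def r_def)
      also have "\<dots> = 1" using 3 by (simp flip: add_divide_distrib)
      finally have "(\<Sum>i\<in>F. (u i + v i) powr r) / (s + t) powr r \<le> 1"
        using 3 nn by (simp add: powr_divide sum_divide_distrib)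
      then show ?thesis using 3 by (simp add: field_simps)
    qed
    then show ?thesis using False nn by (auto simp: lp_le_def r_def)
  qed
qed

lemma lp_le_sum:
  assumes "\<And>k. k \<in> G \<Longrightarrow> lp_le p (u k) (t k)" "1 \<le> p"
  shows "lp_le p (\<lambda>i. \<Sum>k\<in>G. u k i) (\<Sum>k\<in>G. t k)"
  using assms by (induction G rule: infinite_finite_induct) (auto simp: lp_le_zero lp_le_add)

text \<open>A Fatou-type closure property: the predicate constrains only single entries or finite
  sums, and these bounds survive pointwise limits.\<close>

lemma lp_le_tendsto:
  assumes "\<forall>\<^sub>F a in \<F>. lp_le p (f a) t" "\<And>i. ((\<lambda>a. f a i) \<longlongrightarrow> u i) \<F>" "\<F> \<noteq> bot" "1 \<le> p"
  shows "lp_le p u t"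
proof -
  have t: "0 \<le> t" using assms(1,3) lp_le_nonneg eventually_happens by fastforce
  have u: "0 \<le> u i" for i
    by (rule tendsto_lowerbound[OF assms(2) _ assms(3)])
      (use assms(1) in \<open>auto elim!: eventually_mono dest: lp_le_nonneg'\<close>)
  show ?thesis
  proof (cases "p = \<infinity>")
    case True
    have "u i \<le> t" for i
      by (rule tendsto_upperbound[OF assms(2) _ assms(3)])
        (use assms(1) in \<open>auto elim!: eventually_mono dest: lp_le_bound[OF _ assms(4)]\<close>)
    then show ?thesis using True t u by (auto simp: lp_le_def)
  next
    case False
    then have r: "1 \<le> enn2real p" using assms(4) by (rule enn2real_ge_1[rotated])
    have "(\<Sum>i\<in>F. u i powr enn2real p) \<le> t powr enn2real p" if "finite F" for F
    proof (rule tendsto_upperbound[OF _ _ assms(3)])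
      show "((\<lambda>a. \<Sum>i\<in>F. f a i powr enn2real p) \<longlongrightarrow> (\<Sum>i\<in>F. u i powr enn2real p)) \<F>"
        by (intro tendsto_sum tendsto_powr' assms(2) tendsto_const)
          (use assms(1) r in \<open>auto elim!: eventually_mono dest: lp_le_nonneg'\<close>)
      show "\<forall>\<^sub>F a in \<F>. (\<Sum>i\<in>F. f a i powr enn2real p) \<le> t powr enn2real p"
        using assms(1) by eventually_elim (use False that in \<open>auto simp: lp_le_def\<close>)
    qed
    then show ?thesis using False t u by (auto simp: lp_le_def)
  qed
qed

lemma lp_le_infsum:
  assumes u: "\<And>k. lp_le p (u k) (t k)" and t: "t summable_on UNIV" and p: "1 \<le> p"
  shows "lp_le p (\<lambda>i. \<Sum>\<^sub>\<infinity>k. u k i) (\<Sum>\<^sub>\<infinity>k. t k)"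
proof (rule lp_le_tendsto[OF _ _ finite_subsets_at_top_neq_bot p])
  show "((\<lambda>G. \<Sum>k\<in>G. u k i) \<longlongrightarrow> (\<Sum>\<^sub>\<infinity>k. u k i)) (finite_subsets_at_top UNIV)" for i
    by (intro infsum_tendsto summable_on_comparison_test[OF t] lp_le_bound[OF u p] lp_le_nonneg'[OF u])
  show "\<forall>\<^sub>F G in finite_subsets_at_top UNIV. lp_le p (\<lambda>i. \<Sum>k\<in>G. u k i) (\<Sum>\<^sub>\<infinity>k. t k)"
  proof (rule eventually_finite_subsets_at_top_weakI)
    fix G :: "'a set"
    assume G: "finite G" "G \<subseteq> UNIV"
    show "lp_le p (\<lambda>i. \<Sum>k\<in>G. u k i) (\<Sum>\<^sub>\<infinity>k. t k)"
      by (rule lp_le_mono[OF lp_le_sum[OF u p] _ order_refl _ p])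
        (auto intro!: sum_nonneg lp_le_nonneg'[OF u] finite_sum_le_infsum t G lp_le_nonneg[OF u])
  qed
qed

section \<open>Young's inequality for sequences\<close>

definition conv :: "(int \<Rightarrow> real) \<Rightarrow> (int \<Rightarrow> real) \<Rightarrow> int \<Rightarrow> real" where
  "conv K u n = (\<Sum>\<^sub>\<infinity>k. K k * u (n - k))"

text \<open>The convolution is a superposition of translates of \<beta> with coefficients
  \<open>K k\<close>; translation preserves the bound, so Minkowski's inequality for infinite sums
  applies.\<close>

lemma lp_le_conv:
  assumes "lp_le p \<beta> t" "\<And>k. 0 \<le> K k" "K summable_on UNIV" "1 \<le> p"
  shows "lp_le p (conv K \<beta>) ((\<Sum>\<^sub>\<infinity>k. K k) * t)"
proof -
  have "lp_le p (\<lambda>n. \<Sum>\<^sub>\<infinity>k. K k * \<beta> (n + - k)) (\<Sum>\<^sub>\<infinity>k. K k * t)"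
    by (intro lp_le_infsum lp_le_cmult lp_le_shift summable_on_cmult_left assms)
  then show ?thesis by (simp add: infsum_cmult_left' conv_def[abs_def])
qed

text \<open>Young's inequality applied to the unit sequence at 0, which has norm 1 for every
  exponent and is neutral for convolution.\<close>

lemma lp_le_l1:
  fixes u :: "int \<Rightarrow> real"
  assumes "\<And>k. 0 \<le> u k" "u summable_on UNIV" "1 \<le> p"
  shows "lp_le p u (\<Sum>\<^sub>\<infinity>k. u k)"
proof -
  have "lp_le p (\<lambda>i. of_bool (i = 0)) 1"
  proof (cases "p = \<infinity>")
    case False
    have "(\<Sum>i\<in>F. of_bool (i = (0::int)) powr enn2real p) \<le> (1::real)" if "finite F" for F
    proof -
      have "(\<Sum>i\<in>F. of_bool (i = 0) powr enn2real p) = (\<Sum>i\<in>F. if i = (0::int) then 1 else 0 :: real)"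
        by (intro sum.cong) auto
      then show ?thesis using that by simp
    qed
    then show ?thesis using False by (auto simp: lp_le_def)
  qed (auto simp: lp_le_def)
  from lp_le_conv[OF this assms]
  have "lp_le p (\<lambda>n. \<Sum>\<^sub>\<infinity>k. u k * of_bool (n - k = 0)) (\<Sum>\<^sub>\<infinity>k. u k)"
    by (simp add: conv_def[abs_def])
  moreover have "(\<Sum>\<^sub>\<infinity>k. u k * of_bool (n - k = 0)) = u n" for n
    by (subst infsum_cong_neutral[where T = "{n}" and g = u]) auto
  ultimately show ?thesis by simp
qed

lemma lp_le_lp_norm:
  assumes "c \<in> lp_space p" "1 \<le> p"
  shows "lp_le p (\<lambda>i. norm (c i)) (lp_norm p c)"
proof (cases "p = \<infinity>")
  case True
  have "norm (c i) \<le> (SUP j. norm (c j))" for i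
    by (rule cSUP_upper) (use assms True in \<open>auto simp: lp_space_def bounded_iff bdd_above_def\<close>)
  moreover from this[of 0] have "0 \<le> (SUP j. norm (c j))" by (smt (verit) norm_ge_zero)
  ultimately show ?thesis using True by (auto simp: lp_le_def lp_norm_def)
next
  case False
  then have r: "1 \<le> enn2real p" using assms(2) by (rule enn2real_ge_1[rotated])
  have s: "(\<lambda>j. norm (c j) powr enn2real p) summable_on UNIV"
    using assms False by (auto simp: lp_space_def)
  have "lp_norm p c powr enn2real p = (\<Sum>\<^sub>\<infinity>j. norm (c j) powr enn2real p)"
    using False r by (simp add: lp_norm_def powr_powr infsum_nonneg)
  then show ?thesis
    using False s by (auto simp: lp_le_def lp_norm_def intro!: finite_sum_le_infsum)
qed

text \<open>Together with \<open>lp_le_lp_norm\<close> this makes \<open>lp_norm p c\<close> the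
  least constant admissible in \<open>lp_le\<close>, a minimality used when a term is
  absorbed.\<close>

lemma lp_norm_le:
  assumes "lp_le p (\<lambda>i. norm (c i)) t" "1 \<le> p"
  shows "c \<in> lp_space p" "lp_norm p c \<le> t"
proof -
  have "c \<in> lp_space p \<and> lp_norm p c \<le> t"
  proof (cases "p = \<infinity>")
    case True
    then show ?thesis
      using assms by (auto simp: lp_le_def lp_space_def lp_norm_def bounded_iff intro!: cSUP_least)
  next
    case False
    then have r: "1 \<le> enn2real p" using assms(2) by (rule enn2real_ge_1[rotated])
    have *: "(\<Sum>j\<in>F. norm (c j) powr enn2real p) \<le> t powr enn2real p" if "finite F" for F
      using assms that False by (auto simp: lp_le_def)
    have s: "(\<lambda>j. norm (c j) powr enn2real p) summable_on UNIV"
      by (rule nonneg_bdd_above_summable_on) (use * in \<open>auto intro!: bdd_aboveI2\<close>)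
    have "(\<Sum>\<^sub>\<infinity>j. norm (c j) powr enn2real p) \<le> t powr enn2real p"
      by (rule infsum_le_finite_sums[OF s]) (rule *)
    then have "lp_norm p c \<le> (t powr enn2real p) powr (1 / enn2real p)"
      using False r by (simp add: lp_norm_def powr_mono2 infsum_nonneg)
    also have "\<dots> = t" using r lp_le_nonneg[OF assms(1)] by (simp add: powr_powr)
    finally show ?thesis using False s by (auto simp: lp_space_def)
  qed
  then show "c \<in> lp_space p" "lp_norm p c \<le> t" by auto
qed

subsection \<open>Local and global norms on the line\<close>

text \<open>The step function with value \<open>U i\<close> on [i, i + 1) dominates |F|, and since
  these cells have measure 1 its norm on the line is the sequence norm of \<open>U\<close>.\<close>

lemma Lp_norm_le:
  fixes F :: "real \<Rightarrow> complex"
  assumes [measurable]: "F \<in> borel_measurable borel"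
    and F: "\<And>x. norm (F x) \<le> U \<lfloor>x\<rfloor>" and U: "lp_le p U t" and p: "1 \<le> p"
  shows "F \<in> Lp_space p" "Lp_norm p F \<le> t"
proof -
  note t = lp_le_nonneg[OF U] and U0 = lp_le_nonneg'[OF U]
  have "F \<in> Lp_space p \<and> Lp_norm p F \<le> t"
  proof (cases "p = \<infinity>")
    case True
    have "norm (F x) \<le> t" for x
      using F[of x] lp_le_bound[OF U p, of "\<lfloor>x\<rfloor>"] by linarith
    then have "esssup lborel (\<lambda>x. ennreal (norm (F x))) \<le> ennreal t"
      by (intro esssup_I) (auto simp: ennreal_leI)
    then show ?thesis
      using True t by (auto simp: Lp_space_def Lp_norm_def intro: enn2real_leI le_less_trans)
  next
    case False
    define r where "r = enn2real p"
    have r: "1 \<le> r" unfolding r_def using p False by (rule enn2real_ge_1)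
    define f where "f = (\<lambda>x. ennreal (norm (F x) powr r))"
    have [measurable]: "f \<in> borel_measurable borel" unfolding f_def by measurable
    define I where "I m = {- real m..<real m}" for m
    \<comment> \<open>Monotone convergence reduces the integral to finitely many cells, because
      \<open>lp_le\<close> speaks of finite sums only.\<close>
    have lim: "(\<lambda>m. \<integral>\<^sup>+x. f x * indicator (I m) x \<partial>lborel) \<longlonglongrightarrow> (\<integral>\<^sup>+x. f x \<partial>lborel)"
    proof (rule nn_integral_LIMSEQ)
      show "incseq (\<lambda>m x. f x * indicator (I m) x)"
        by (auto simp: incseq_def le_fun_def I_def split: split_indicator)
      show "(\<lambda>m. f x * indicator (I m) x) \<longlonglongrightarrow> f x" for x
      proof (rule tendsto_eventually)
        obtain M where "\<bar>x\<bar> < real M" using reals_Archimedean2 by blast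
        then show "\<forall>\<^sub>F m in sequentially. f x * indicator (I m) x = f x"
          by (intro eventually_sequentiallyI[of M]) (auto simp: I_def split: split_indicator)
      qed
    qed (auto simp: I_def)
    have "(\<integral>\<^sup>+x. f x * indicator (I m) x \<partial>lborel) \<le> ennreal (t powr r)" for m
    proof -
      let ?J = "{- int m..<int m}"
      have "(\<integral>\<^sup>+x. f x * indicator (I m) x \<partial>lborel)
          \<le> (\<integral>\<^sup>+x. (\<Sum>i\<in>?J. ennreal (U i powr r) * indicator {real_of_int i..<real_of_int i + 1} x) \<partial>lborel)"
      proof (rule nn_integral_mono)
        fix x :: real
        show "f x * indicator (I m) x
            \<le> (\<Sum>i\<in>?J. ennreal (U i powr r) * indicator {real_of_int i..<real_of_int i + 1} x)"
        proof (cases "x \<in> I m")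
          case True
          then have "\<lfloor>x\<rfloor> \<in> ?J" by (auto simp: I_def le_floor_iff floor_less_iff)
          moreover have "f x \<le> ennreal (U \<lfloor>x\<rfloor> powr r)"
            unfolding f_def using r F by (intro ennreal_leI powr_mono2) auto
          ultimately show ?thesis using True
            by (intro order_trans[OF _ member_le_sum[of "\<lfloor>x\<rfloor>"]]) auto
        qed auto
      qed
      also have "\<dots> = (\<Sum>i\<in>?J. ennreal (U i powr r))"
        by (subst nn_integral_sum) (auto simp: nn_integral_cmult_indicator)
      also have "\<dots> = ennreal (\<Sum>i\<in>?J. U i powr r)" by (simp add: sum_ennreal)
      also have "\<dots> \<le> ennreal (t powr r)"
        using U False by (intro ennreal_leI) (auto simp: lp_le_def r_def)
      finally show ?thesis .
    qed
    then have le: "(\<integral>\<^sup>+x. f x \<partial>lborel) \<le> ennreal (t powr r)"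
      by (intro LIMSEQ_le_const2[OF lim]) auto
    then have int: "integrable lborel (\<lambda>x. norm (F x) powr r)"
      unfolding f_def by (intro integrableI_bounded) (auto intro: le_less_trans)
    have "(LINT x|lborel. norm (F x) powr r) \<le> t powr r"
      using le unfolding f_def by (subst (asm) nn_integral_eq_integral[OF int]) auto
    then have "Lp_norm p F \<le> (t powr r) powr (1 / r)"
      using False r by (simp add: Lp_norm_def r_def[symmetric] powr_mono2 integral_nonneg_AE)
    also have "\<dots> = t" using r t by (simp add: powr_powr)
    finally show ?thesis using False int by (auto simp: Lp_space_def r_def)
  qed
  then show "F \<in> Lp_space p" "Lp_norm p F \<le> t" by auto
qed

section \<open>Jensen's inequality and averages over unit intervals\<close>

lemma powr_tangent_le:
  fixes s y r :: real
  assumes "1 \<le> r" "0 < s" "0 \<le> y"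
  shows "s powr r + r * s powr (r - 1) * (y - s) \<le> y powr r"
proof -
  have "((\<lambda>x. x powr r) has_field_derivative r * s powr (r - 1)) (at s within {0..})"
    using assms by (auto intro!: derivative_eq_intros simp: powr_diff)
  then have "r * s powr (r - 1) * (y - s) \<le> y powr r - s powr r"
    using assms by (intro convex_on_imp_above_tangent[OF convex_on_powr_nonneg]) auto
  then show ?thesis by simp
qed

text \<open>Jensen's inequality: integrate the tangent line of the r-th power at the mean
  \<open>s\<close>. Its linear part integrates to 0 because the interval has length 1. The tangent
  bound requires \<open>s\<close> positive, hence the separate case \<open>s = 0\<close>.\<close>

lemma integral_powr_le:
  fixes f :: "real \<Rightarrow> real" and a :: real
  assumes f: "continuous_on {a..a + 1} f" "\<And>x. 0 \<le> f x" and r: "1 \<le> r"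
  shows "(integral {a..a + 1} f) powr r \<le> integral {a..a + 1} (\<lambda>x. f x powr r)"
proof -
  define s where "s = integral {a..a + 1} f"
  have s0: "0 \<le> s" unfolding s_def
    using f by (intro integral_nonneg integrable_continuous_real) auto
  have fr: "continuous_on {a..a + 1} (\<lambda>x. f x powr r)"
    using f r by (intro continuous_on_powr' continuous_on_const) auto
  show ?thesis
  proof (cases "s = 0")
    case True
    have "0 \<le> integral {a..a + 1} (\<lambda>x. f x powr r)"
      by (intro integral_nonneg integrable_continuous_real fr) auto
    then show ?thesis using True r by (simp add: s_def[symmetric])
  next
    case False
    then have s: "0 < s" using s0 by simp
    let ?d = "r * s powr (r - 1)"
    have "((\<lambda>x. ?d * f x + (s powr r - ?d * s)) has_integral
        (?d * s + (s powr r - ?d * s) * (a + 1 - a))) {a..a + 1}"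
      using f integrable_integral[OF integrable_continuous_real[OF f(1)]]
        has_integral_const_real[of "s powr r - ?d * s" a "a + 1"]
      unfolding s_def[symmetric]
      by (intro has_integral_add has_integral_mult_right) (auto simp: mult.commute)
    moreover have "((\<lambda>x. f x powr r) has_integral integral {a..a + 1} (\<lambda>x. f x powr r)) {a..a + 1}"
      using fr integrable_continuous_real by blast
    ultimately have "?d * s + (s powr r - ?d * s) * (a + 1 - a) \<le> integral {a..a + 1} (\<lambda>x. f x powr r)"
      by (rule has_integral_le)
        (use powr_tangent_le[OF r s f(2)] in \<open>simp add: algebra_simps\<close>)
    then show ?thesis by (simp add: s_def[symmetric])
  qed
qed

text \<open>Half-open cells tile the line without overlap, which lets integrals over several cells
  be added and compared with the integral over the line.\<close>

lemma integral_unit_interval_eq: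
  fixes f :: "real \<Rightarrow> real" and a :: real
  assumes "continuous_on {a..a + 1} f"
  shows "set_integrable lborel {a..<a + 1} f"
    "integral {a..a + 1} f = (LINT x:{a..<a + 1}|lborel. f x)"
proof -
  show int: "set_integrable lborel {a..<a + 1} f"
    by (rule set_integrable_subset[OF borel_integrable_atLeastAtMost'[OF assms]]) auto
  have "integral {a..a + 1} f = integral {a..<a + 1} f"
    by (rule integral_spike_set) (auto intro: negligible_subset[of "{a + 1}"])
  then show "integral {a..a + 1} f = (LINT x:{a..<a + 1}|lborel. f x)"
    using set_borel_integral_eq_integral(2)[OF int] by simp
qed

text \<open>For finite q apply Jensen on each cell and add up; for infinite q a mean over a unit
  cell is at most the essential supremum.\<close>

lemma lp_le_unit_integrals:
  fixes F :: "real \<Rightarrow> complex"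
  assumes F: "F \<in> Lp_space q" and cont: "continuous_on UNIV F" and q: "1 \<le> q"
  shows "lp_le q (\<lambda>i. integral {real_of_int i..real_of_int i + 1} (\<lambda>x. norm (F x))) (Lp_norm q F)"
proof -
  define g where "g i = integral {real_of_int i..real_of_int i + 1} (\<lambda>x. norm (F x))" for i :: int
  have cF: "continuous_on S (\<lambda>x. norm (F x))" for S
    by (intro continuous_on_norm continuous_on_subset[OF cont]) auto
  have g0: "0 \<le> g i" for i
    unfolding g_def by (intro integral_nonneg integrable_continuous_real cF) auto
  have N: "0 \<le> Lp_norm q F" by (auto simp: Lp_norm_def)
  have "lp_le q g (Lp_norm q F)"
  proof (cases "q = \<infinity>")
    case True
    let ?M = "esssup lborel (\<lambda>x. ennreal (norm (F x)))"
    have M: "?M < \<infinity>" "Lp_norm q F = enn2real ?M"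
      using F True by (auto simp: Lp_space_def Lp_norm_def)
    have AE: "AE x in lborel. norm (F x) \<le> Lp_norm q F"
      using esssup_AE[of "\<lambda>x. ennreal (norm (F x))" lborel]
    proof eventually_elim
      case (elim x)
      then show ?case using M
        by (metis enn2real_ennreal enn2real_mono infinity_ennreal_def norm_ge_zero)
    qed
    have "g i \<le> Lp_norm q F" for i
    proof -
      let ?I = "{real_of_int i..<real_of_int i + 1}"
      have "g i = (LINT x:?I|lborel. norm (F x))"
        unfolding g_def by (rule integral_unit_interval_eq[OF cF])
      also have "\<dots> \<le> (LINT x:?I|lborel. Lp_norm q F)"
        unfolding set_lebesgue_integral_def
        using AE integral_unit_interval_eq(1)[OF cF, of "real_of_int i"]
          integral_unit_interval_eq(1)[of "real_of_int i" "\<lambda>_. Lp_norm q F"]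
        by (intro integral_mono_AE)
          (auto simp: set_integrable_def elim!: eventually_mono split: split_indicator)
      also have "\<dots> = Lp_norm q F"
        by (subst set_integral_const) auto
      finally show ?thesis .
    qed
    then show ?thesis using True N g0 by (auto simp: lp_le_def)
  next
    case False
    define r where "r = enn2real q"
    have r: "1 \<le> r" unfolding r_def using q False by (rule enn2real_ge_1)
    have int: "integrable lborel (\<lambda>x. norm (F x) powr r)"
      using F False by (auto simp: Lp_space_def r_def)
    have cr: "continuous_on S (\<lambda>x. norm (F x) powr r)" for S
      using r by (intro continuous_on_powr' cF continuous_on_const) auto
    have "(\<Sum>i\<in>A. g i powr r) \<le> Lp_norm q F powr r" if A: "finite A" for A
    proof -
      let ?I = "\<lambda>i::int. {real_of_int i..<real_of_int i + 1}"
      have "(\<Sum>i\<in>A. g i powr r) \<le> (\<Sum>i\<in>A. (LINT x:?I i|lborel. norm (F x) powr r))"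
        unfolding g_def integral_unit_interval_eq(2)[OF cr, symmetric]
        by (intro sum_mono integral_powr_le cF r) auto
      also have "\<dots> = (LINT x|lborel. (\<Sum>i\<in>A. indicator (?I i) x *\<^sub>R norm (F x) powr r))"
        unfolding set_lebesgue_integral_def
        using integral_unit_interval_eq(1)[OF cr]
        by (subst Bochner_Integration.integral_sum) (auto simp: set_integrable_def)
      also have "\<dots> \<le> (LINT x|lborel. norm (F x) powr r)"
      proof (rule integral_mono)
        show "integrable lborel (\<lambda>x. \<Sum>i\<in>A. indicator (?I i) x *\<^sub>R norm (F x) powr r)"
          using integral_unit_interval_eq(1)[OF cr]
          by (intro Bochner_Integration.integrable_sum) (auto simp: set_integrable_def)
        fix x :: real
        have "(\<Sum>i\<in>A. indicator (?I i) x *\<^sub>R norm (F x) powr r)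
            = (\<Sum>i\<in>A. if i = \<lfloor>x\<rfloor> then norm (F x) powr r else 0)"
          by (intro sum.cong) (auto simp: indicator_def floor_unique floor_eq_iff)
        also have "\<dots> \<le> norm (F x) powr r" using A by simp
        finally show "(\<Sum>i\<in>A. indicator (?I i) x *\<^sub>R norm (F x) powr r) \<le> norm (F x) powr r" .
      qed (rule int)
      also have "\<dots> = Lp_norm q F powr r"
        using False r by (simp add: Lp_norm_def r_def[symmetric] powr_powr integral_nonneg_AE)
      finally show ?thesis .
    qed
    then show ?thesis using False N g0 by (auto simp: lp_le_def r_def)
  qed
  then show ?thesis by (simp add: g_def[abs_def])
qed

subsection \<open>Convolution and exponential weights\<close>

text \<open>The second form, obtained by reflecting k = n - j, is the one in which majorants of the
  synthesis series appear.\<close>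

lemma conv_has_sum:
  assumes K: "\<And>k. 0 \<le> K k" "K summable_on UNIV" and u: "\<And>j. 0 \<le> u j" "\<And>j. u j \<le> B"
  shows "((\<lambda>k. K k * u (n - k)) has_sum conv K u n) UNIV"
    "((\<lambda>j. K (n - j) * u j) has_sum conv K u n) UNIV"
proof -
  have "(\<lambda>k. K k * u (n - k)) summable_on UNIV"
    using K u by (intro summable_on_comparison_test[OF summable_on_cmult_left[OF K(2), of B]])
      (auto intro: mult_left_mono)
  then show 1: "((\<lambda>k. K k * u (n - k)) has_sum conv K u n) UNIV"
    unfolding conv_def by (rule has_sum_infsum)
  have "bij_betw (\<lambda>j. n - j) UNIV (UNIV :: int set)"
    by (rule bij_betwI[where g = "\<lambda>j. n - j"]) auto
  from has_sum_reindex_bij_betw[OF this, of "\<lambda>k. K k * u (n - k)"] 1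
  show "((\<lambda>j. K (n - j) * u j) has_sum conv K u n) UNIV" by simp
qed

lemma norm_infsum_le_conv:
  fixes a :: "int \<Rightarrow> complex"
  assumes K: "\<And>k. 0 \<le> K k" "K summable_on UNIV" and u: "\<And>j. 0 \<le> u j" "\<And>j. u j \<le> B"
    and a: "\<And>j. norm (a j) \<le> K (n - j) * u j"
  shows "a summable_on UNIV" "norm (\<Sum>\<^sub>\<infinity>j. a j) \<le> conv K u n"
proof -
  note hs = conv_has_sum(2)[where B = B, OF K u, of n]
  have "(\<lambda>j. norm (a j)) summable_on UNIV"
    by (rule summable_on_comparison_test[OF has_sum_imp_summable[OF hs]]) (use a in auto)
  then show s: "a summable_on UNIV" by (rule abs_summable_summable)
  show "norm (\<Sum>\<^sub>\<infinity>j. a j) \<le> conv K u n"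
    by (rule norm_infsum_le[OF has_sum_infsum[OF s] hs]) (rule a)
qed

lemma conv_nonneg:
  assumes "\<And>k. 0 \<le> K k" "\<And>j. 0 \<le> u j"
  shows "0 \<le> conv K u n"
  unfolding conv_def using assms by (intro infsum_nonneg) auto

lemma conv_add_cmult:
  assumes K: "\<And>k. 0 \<le> K k" "K summable_on UNIV"
    and u: "\<And>j. 0 \<le> u j" "\<And>j. u j \<le> B" and v: "\<And>j. 0 \<le> v j" "\<And>j. v j \<le> B'"
  shows "conv K (\<lambda>j. a * u j + v j) n = a * conv K u n + conv K v n"
proof -
  have "((\<lambda>k. a * (K k * u (n - k)) + K k * v (n - k)) has_sum (a * conv K u n + conv K v n)) UNIV"
    by (intro has_sum_add has_sum_cmult_right conv_has_sum(1)[where B = B] conv_has_sum(1)[where B = B'] K u v)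
  then show ?thesis
    unfolding conv_def by (intro infsumI) (simp add: algebra_simps)
qed

text \<open>Since w(i - n) = w((i - k) - (n - k)), the term with index \<open>k\<close> is a
  translate of the sequence weighted around n - k, so its bound is
  \<open>K k * \<beta> (n - k)\<close>. Minkowski's inequality then yields a convolution of \<beta>,
  whatever the exponent p.\<close>

lemma lp_le_weight_conv:
  assumes b: "\<And>n. lp_le p (\<lambda>i. w (i - n) * u i) (\<beta> n)" and \<beta>: "\<And>n. \<beta> n \<le> B"
    and K: "\<And>k. 0 \<le> K k" "K summable_on UNIV" and p: "1 \<le> p"
  shows "lp_le p (\<lambda>i. w (i - n) * conv K u i) (conv K \<beta> n)"
proof -
  have "lp_le p (\<lambda>i. K k * (w (i - n) * u (i - k))) (K k * \<beta> (n - k))" for k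
    using lp_le_cmult[OF lp_le_shift[OF b[of "n - k"], where k = "- k"] K(1)[of k]]
    by (simp add: algebra_simps)
  then have "lp_le p (\<lambda>i. \<Sum>\<^sub>\<infinity>k. K k * (w (i - n) * u (i - k))) (\<Sum>\<^sub>\<infinity>k. K k * \<beta> (n - k))"
    by (rule lp_le_infsum[OF _ has_sum_imp_summable[OF conv_has_sum(1)[where B = B, OF K]] p])
      (use \<beta> lp_le_nonneg[OF b] in auto)
  then show ?thesis
    by (simp add: conv_def[abs_def] mult.left_commute flip: infsum_cmult_right')
qed

lemma summable_on_exp_abs:
  assumes "0 < \<mu>"
  shows "(\<lambda>k::int. exp (- \<mu> * \<bar>real_of_int k\<bar>)) summable_on UNIV"
proof -
  let ?w = "\<lambda>k::int. exp (- \<mu> * \<bar>real_of_int k\<bar>)"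
  have "summable (\<lambda>n. exp (- \<mu>) ^ n)" using assms by (intro summable_geometric) auto
  then have s: "(\<lambda>n. exp (- \<mu>) ^ n) summable_on (UNIV :: nat set)"
    by (intro summable_nonneg_imp_summable_on) auto
  have eq: "exp (- \<mu>) ^ n = exp (- \<mu> * real n)" for n
    by (simp add: mult.commute flip: exp_of_nat_mult)
  have "?w summable_on range int"
    using s unfolding eq by (subst summable_on_reindex) (auto simp: o_def)
  moreover have "?w summable_on range (\<lambda>n. - int n)"
    using s unfolding eq by (subst summable_on_reindex) (auto simp: o_def inj_on_def)
  moreover have "range int \<union> range (\<lambda>n. - int n) = UNIV"
    by (metis (no_types, lifting) UNIV_eq_I UnCI int_cases2 rangeI)
  ultimately show ?thesis by (metis summable_on_union)
qed

lemma exp_abs_diff_le: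
  fixes i j n \<mu> :: real
  assumes "0 \<le> \<mu>"
  shows "\<bar>exp (- \<mu> * \<bar>i - n\<bar>) - exp (- \<mu> * \<bar>j - n\<bar>)\<bar>
    \<le> (1 - exp (- \<mu> * \<bar>i - j\<bar>)) * (exp (- \<mu> * \<bar>i - n\<bar>) + exp (- \<mu> * \<bar>j - n\<bar>))"
proof -
  \<comment> \<open>One-sided form, with \<open>a\<close>, \<open>b\<close>, \<open>d\<close>
    standing for \<mu> times the distances i to n, j to n and i to j. It is used twice, with
    \<open>a\<close> and \<open>b\<close> exchanged; the sum of both exponentials on the right makes
    the bound symmetric.\<close>
  have *: "exp (- a) - exp (- b) \<le> (1 - exp (- d)) * (exp (- a) + exp (- b))"
    if "b \<le> a + d" "0 \<le> d" for a b d :: real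
  proof -
    have "exp (- a) * exp (- d) \<le> exp (- b)" using that by (simp flip: exp_add)
    then have "exp (- a) - exp (- b) \<le> (1 - exp (- d)) * exp (- a)" by (simp add: algebra_simps)
    also have "\<dots> \<le> (1 - exp (- d)) * (exp (- a) + exp (- b))"
      using that by (intro mult_left_mono) auto
    finally show ?thesis .
  qed
  have "\<mu> * \<bar>j - n\<bar> \<le> \<mu> * \<bar>i - n\<bar> + \<mu> * \<bar>i - j\<bar>" "\<mu> * \<bar>i - n\<bar> \<le> \<mu> * \<bar>j - n\<bar> + \<mu> * \<bar>i - j\<bar>"
    using assms by (auto simp flip: distrib_left intro!: mult_left_mono)
  from this[THEN *] show ?thesis using assms by (simp add: abs_le_iff add.commute)
qed

text \<open>Dominated convergence by hand: a finite set \<open>A\<close> carries all but e/2 of the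
  sum of \<open>H\<close>. On \<open>A\<close> the kernel tends to 0 with \<mu>, and off
  \<open>A\<close> it is at most \<open>H\<close>.\<close>

lemma exp_commutator_kernel_small:
  assumes H: "\<And>k. 0 \<le> H k" "H summable_on UNIV" and e: "0 < e"
  obtains \<mu> where "0 < \<mu>" "(\<lambda>k. H k * (1 - exp (- \<mu> * \<bar>real_of_int k\<bar>))) summable_on UNIV"
    "(\<Sum>\<^sub>\<infinity>k. H k * (1 - exp (- \<mu> * \<bar>real_of_int k\<bar>))) \<le> e"
proof -
  define K where "K \<mu> k = H k * (1 - exp (- \<mu> * \<bar>real_of_int k\<bar>))" for \<mu> k
  have K: "0 \<le> K \<mu> k" "K \<mu> k \<le> H k" if "0 < \<mu>" for \<mu> k
    using that H(1)[of k] by (auto simp: K_def mult_left_le)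
  obtain A where A: "finite A" "dist (sum H A) (infsum H UNIV) \<le> e / 2"
    using infsum_finite_approximation[OF H(2), of "e / 2"] e by auto
  have "((\<lambda>\<mu>. \<Sum>k\<in>A. K \<mu> k) \<longlongrightarrow> (\<Sum>k\<in>A. H k * (1 - exp (- 0 * \<bar>real_of_int k\<bar>)))) (at_right 0)"
    unfolding K_def by (intro tendsto_intros)
  then have "\<forall>\<^sub>F \<mu> in at_right 0. (\<Sum>k\<in>A. K \<mu> k) < e / 2"
    using e by (intro order_tendstoD(2)) auto
  then have "\<forall>\<^sub>F \<mu> in at_right 0. (\<Sum>k\<in>A. K \<mu> k) < e / 2 \<and> 0 < \<mu>"
    by (intro eventually_conj eventually_at_right_less)
  then obtain \<mu> where l: "(\<Sum>k\<in>A. K \<mu> k) < e / 2" "0 < \<mu>"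
    using eventually_happens[of _ "at_right (0::real)"] by auto
  have s: "K \<mu> summable_on UNIV"
    by (rule summable_on_comparison_test[OF H(2)]) (use K l in auto)
  have "infsum (K \<mu>) UNIV \<le> e"
  proof (rule infsum_le_finite_sums[OF s])
    fix G :: "int set"
    assume G: "finite G"
    have "sum (K \<mu>) G \<le> sum (K \<mu>) (A \<union> (G - A))"
      using G A K l by (intro sum_mono2) auto
    also have "\<dots> = sum (K \<mu>) A + sum (K \<mu>) (G - A)"
      using G A by (intro sum.union_disjoint) auto
    also have "sum (K \<mu>) (G - A) \<le> sum H (G - A)" using K l by (intro sum_mono) auto
    also have "sum H (G - A) = sum H (A \<union> (G - A)) - sum H A"
      using G A by (subst sum.union_disjoint) auto
    also have "sum H (A \<union> (G - A)) \<le> infsum H UNIV"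
      using G A H by (intro finite_sum_le_infsum) auto
    finally show "sum (K \<mu>) G \<le> e" using l A(2) unfolding dist_real_def by linarith
  qed
  then show thesis using that[of \<mu>] l s by (simp add: K_def[abs_def])
qed

subsection \<open>Localized families\<close>

text \<open>The hypotheses with h and \<omega> eliminated. All bounds depend on \<open>x\<close>
  only through its unit cell, so that sums over \<open>j\<close> become convolutions of sequences
  evaluated at \<open>\<lfloor>x\<rfloor>\<close>.\<close>

locale localized_family =
  fixes \<phi> :: "int \<Rightarrow> real \<Rightarrow> complex" and H :: "int \<Rightarrow> real"
  assumes H_nonneg: "0 \<le> H k"
    and H_summable: "H summable_on UNIV"
    and norm_le: "norm (\<phi> j x) \<le> H (\<lfloor>x\<rfloor> - j)"
    and modulus: "0 < e \<Longrightarrow>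
      \<exists>d>0. d \<le> 1 \<and> (\<forall>j x y. \<bar>y - x\<bar> \<le> d \<longrightarrow> norm (\<phi> j y - \<phi> j x) \<le> e * H (\<lfloor>x\<rfloor> - j))"
begin

lemma synthesis_has_sum:
  assumes "\<And>j. norm (c j) \<le> B"
  shows "((\<lambda>j. c j * \<phi> j x) has_sum synthesis \<phi> c x) UNIV"
    "norm (synthesis \<phi> c x) \<le> conv H (\<lambda>j. norm (c j)) \<lfloor>x\<rfloor>"
proof -
  have *: "norm (c j * \<phi> j x) \<le> H (\<lfloor>x\<rfloor> - j) * norm (c j)" for j
    using norm_le[of j x] by (simp add: norm_mult mult.commute mult_left_mono)
  note ** = norm_infsum_le_conv[where B = B and u = "\<lambda>j. norm (c j)",
      OF H_nonneg H_summable norm_ge_zero assms *]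
  show "((\<lambda>j. c j * \<phi> j x) has_sum synthesis \<phi> c x) UNIV"
    unfolding synthesis_def by (rule has_sum_infsum[OF **(1)])
  show "norm (synthesis \<phi> c x) \<le> conv H (\<lambda>j. norm (c j)) \<lfloor>x\<rfloor>"
    unfolding synthesis_def by (rule **(2))
qed

lemma synthesis_modulus:
  assumes c: "\<And>j. norm (c j) \<le> B" and e: "0 \<le> e"
    and d: "\<And>j. norm (\<phi> j y - \<phi> j x) \<le> e * H (\<lfloor>x\<rfloor> - j)"
  shows "norm (synthesis \<phi> c y - synthesis \<phi> c x) \<le> e * conv H (\<lambda>j. norm (c j)) \<lfloor>x\<rfloor>"
proof (rule norm_infsum_le)
  show "((\<lambda>j. c j * \<phi> j y - c j * \<phi> j x) has_sum (synthesis \<phi> c y - synthesis \<phi> c x)) UNIV"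
    using has_sum_add[OF synthesis_has_sum(1)[OF c, where x = y]
        has_sum_uminusI[OF synthesis_has_sum(1)[OF c, where x = x]]] by simp
  show "((\<lambda>j. e * (H (\<lfloor>x\<rfloor> - j) * norm (c j))) has_sum (e * conv H (\<lambda>j. norm (c j)) \<lfloor>x\<rfloor>)) UNIV"
    by (intro has_sum_cmult_right conv_has_sum(2)[where B = B] H_nonneg H_summable c norm_ge_zero)
  show "norm (c j * \<phi> j y - c j * \<phi> j x) \<le> e * (H (\<lfloor>x\<rfloor> - j) * norm (c j))" for j
    using mult_left_mono[OF d[of j], of "norm (c j)"]
    by (simp add: norm_mult mult_ac flip: right_diff_distrib)
qed

lemma conv_H_le:
  assumes "\<And>j. norm (c j) \<le> B"
  shows "conv H (\<lambda>j. norm (c j)) n \<le> infsum H UNIV * B"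
proof -
  have "0 \<le> B" using assms[of 0] by (smt (verit) norm_ge_zero)
  then have "lp_le \<infinity> (\<lambda>j. norm (c j)) B" using assms by (auto simp: lp_le_def)
  from lp_le_conv[OF this H_nonneg H_summable] show ?thesis
    by (auto intro: lp_le_bound)
qed

text \<open>Supplies measurability of the synthesized function and the existence of its integrals
  over bounded intervals.\<close>

lemma continuous_synthesis:
  assumes c: "\<And>j. norm (c j) \<le> B"
  shows "continuous_on UNIV (synthesis \<phi> c)"
proof -
  \<comment> \<open>The added 1 makes the bound on the convolution strict and keeps \<open>M\<close>
    positive.\<close>
  define M where "M = infsum H UNIV * B + 1"
  have M: "conv H (\<lambda>j. norm (c j)) n < M" for n
    using conv_H_le[of c B n, OF c] by (simp add: M_def)
  have M0: "0 < M" using M[of 0] conv_nonneg[of H "\<lambda>j. norm (c j)" 0] H_nonneg by force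
  show ?thesis
    unfolding continuous_on_iff
  proof (intro ballI allI impI)
    fix x e :: real
    assume e: "0 < e"
    then obtain d where d: "0 < d"
      "\<forall>j x y. \<bar>y - x\<bar> \<le> d \<longrightarrow> norm (\<phi> j y - \<phi> j x) \<le> e / M * H (\<lfloor>x\<rfloor> - j)"
      using modulus[of "e / M"] M0 by auto
    have "dist (synthesis \<phi> c y) (synthesis \<phi> c x) < e" if "dist y x < d" for y
    proof -
      have "norm (synthesis \<phi> c y - synthesis \<phi> c x) \<le> e / M * conv H (\<lambda>j. norm (c j)) \<lfloor>x\<rfloor>"
        using d that e M0 by (intro synthesis_modulus[where B = B, OF c]) (auto simp: dist_real_def)
      also have "\<dots> < e / M * M" using M e M0 by (intro mult_strict_left_mono) auto
      finally show ?thesis using M0 by (simp add: dist_norm)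
    qed
    then show "\<exists>d>0. \<forall>y\<in>UNIV. dist y x < d \<longrightarrow> dist (synthesis \<phi> c y) (synthesis \<phi> c x) < e"
      using d(1) by blast
  qed
qed

text \<open>The bound does not see the exponent: averaging over an interval of length \<open>d\<close> compares
  all local \<open>L\<^sup>p\<close> norms at once.\<close>

lemma synthesis_le_local_average:
  assumes c: "\<And>j. norm (c j) \<le> B" and e: "0 \<le> e" and d: "0 < d" "d \<le> 1"
    and osc: "\<And>j x y. \<bar>y - x\<bar> \<le> d \<Longrightarrow> norm (\<phi> j y - \<phi> j x) \<le> e * H (\<lfloor>x\<rfloor> - j)"
  defines "g \<equiv> \<lambda>i. integral {real_of_int i..real_of_int i + 1} (\<lambda>x. norm (synthesis \<phi> c x))"
  shows "norm (synthesis \<phi> c x) \<le> (g \<lfloor>x\<rfloor> + g (\<lfloor>x\<rfloor> + 1)) / d + e * conv H (\<lambda>j. norm (c j)) \<lfloor>x\<rfloor>"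
proof -
  let ?F = "\<lambda>x. norm (synthesis \<phi> c x)" and ?a = "conv H (\<lambda>j. norm (c j)) \<lfloor>x\<rfloor>"
  let ?i = "real_of_int \<lfloor>x\<rfloor>"
  have int: "?F integrable_on {s..t}" for s t
    by (intro integrable_continuous_real continuous_on_norm
        continuous_on_subset[OF continuous_synthesis[where B = B, OF c]]) auto
  have "d * ?F x = integral {x..x + d} (\<lambda>_. ?F x)" using d by simp
  also have "\<dots> \<le> integral {x..x + d} (\<lambda>y. ?F y + e * ?a)"
  proof (rule integral_le)
    fix y
    assume "y \<in> {x..x + d}"
    then have "norm (synthesis \<phi> c y - synthesis \<phi> c x) \<le> e * ?a"
      by (intro synthesis_modulus[where B = B, OF c e] osc) auto
    then show "?F x \<le> ?F y + e * ?a"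
      using norm_triangle_ineq2[of "synthesis \<phi> c x" "synthesis \<phi> c y"] by (simp add: norm_minus_commute)
  qed (intro integrable_add int integrable_const_ivl)+
  also have "\<dots> = integral {x..x + d} ?F + d * (e * ?a)"
    using d by (subst integral_add) (auto intro!: int integrable_const_ivl)
  \<comment> \<open>As \<open>d \<le> 1\<close>, the interval starts in the cell of \<open>x\<close>
    and may reach into the next one, which is why two consecutive values of \<open>g\<close>
    occur.\<close>
  also have "integral {x..x + d} ?F \<le> integral {?i..?i + 2} ?F"
  proof (rule integral_subset_le)
    have "?i \<le> x" "x \<le> ?i + 1" by linarith+
    then show "{x..x + d} \<subseteq> {?i..?i + 2}" using d(2) unfolding atLeastatMost_subset_iff by linarith
  qed (auto intro: int)
  also have "integral {?i..?i + 2} ?F = g \<lfloor>x\<rfloor> + g (\<lfloor>x\<rfloor> + 1)"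
    using Henstock_Kurzweil_Integration.integral_combine[of ?i "?i + 1" "?i + 2" ?F] int
    by (simp add: g_def algebra_simps)
  finally show ?thesis using d by (simp add: field_simps)
qed

text \<open>Young's inequality with the kernel \<open>H\<close>. It holds for every exponent without
  any stability assumption, so only the lower bound has to be transferred.\<close>

lemma synthesis_upper_bound:
  assumes c: "c \<in> lp_space q" and q: "1 \<le> q"
  shows "synthesis \<phi> c \<in> Lp_space q" "Lp_norm q (synthesis \<phi> c) \<le> infsum H UNIV * lp_norm q c"
proof -
  note n = lp_le_lp_norm[OF c q]
  have B: "norm (c j) \<le> lp_norm q c" for j by (rule lp_le_bound[OF n q])
  note * = Lp_norm_le[OF borel_measurable_continuous_onI[OF continuous_synthesis[OF B]]
      synthesis_has_sum(2)[OF B] lp_le_conv[OF n H_nonneg H_summable q] q]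
  show "synthesis \<phi> c \<in> Lp_space q" "Lp_norm q (synthesis \<phi> c) \<le> infsum H UNIV * lp_norm q c"
    by (rule *)+
qed

lemma synthesis_weighted_le:
  fixes c :: "int \<Rightarrow> complex"
  assumes c: "\<And>j. norm (c j) \<le> B" and m: "0 < \<mu>"
    and K: "(\<lambda>k. H k * (1 - exp (- \<mu> * \<bar>real_of_int k\<bar>))) summable_on UNIV" (is "?K summable_on _")
  defines "w \<equiv> \<lambda>k::int. exp (- \<mu> * \<bar>real_of_int k\<bar>)"
  shows "norm (synthesis \<phi> (\<lambda>j. of_real (w (j - n)) * c j) x)
    \<le> w (\<lfloor>x\<rfloor> - n) * norm (synthesis \<phi> c x)
      + (w (\<lfloor>x\<rfloor> - n) * conv ?K (\<lambda>j. norm (c j)) \<lfloor>x\<rfloor> + conv ?K (\<lambda>j. w (j - n) * norm (c j)) \<lfloor>x\<rfloor>)"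
proof -
  let ?i = "\<lfloor>x\<rfloor>"
  have w: "0 \<le> w k" "w k \<le> 1" for k using m by (auto simp: w_def)
  have K0: "0 \<le> ?K k" for k using H_nonneg[of k] m by auto
  have wB: "w k * norm (c j) \<le> B" for k j
    using w[of k] c[of j] by (auto intro!: order_trans[OF mult_left_le_one_le])
  have wc: "norm (of_real (w (j - n)) * c j) \<le> B" for j
    using wB w(1) by (simp add: norm_mult)
  \<comment> \<open>The commutator term by term: its coefficients are the differences between the
    weight at \<open>j\<close> and the weight at the cell of \<open>x\<close>.\<close>
  let ?D = "\<lambda>j. (of_real (w (j - n)) * c j) * \<phi> j x - of_real (w (?i - n)) * (c j * \<phi> j x)"
  have D: "(?D has_sum (synthesis \<phi> (\<lambda>j. of_real (w (j - n)) * c j) x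
      - of_real (w (?i - n)) * synthesis \<phi> c x)) UNIV"
    using has_sum_add[OF synthesis_has_sum(1)[of "\<lambda>j. of_real (w (j - n)) * c j", OF wc, where x = x]
        has_sum_uminusI[OF has_sum_cmult_right[OF synthesis_has_sum(1)[of c, OF c, where x = x]]]] by simp
  \<comment> \<open>The first summand has a weight independent of \<open>j\<close>, which leaves the
    convolution as a factor; the second keeps its weight inside.\<close>
  let ?u = "\<lambda>j. w (?i - n) * norm (c j) + w (j - n) * norm (c j)"
  have "norm (?D j) \<le> ?K (?i - j) * ?u j" for j
  proof -
    have "?D j = of_real (w (j - n) - w (?i - n)) * (c j * \<phi> j x)" by (simp add: algebra_simps)
    then have "norm (?D j) = \<bar>w (?i - n) - w (j - n)\<bar> * (norm (c j) * norm (\<phi> j x))"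
      by (simp only: norm_mult norm_of_real abs_minus_commute)
    also have "\<dots> \<le> ((1 - exp (- \<mu> * \<bar>real_of_int (?i - j)\<bar>)) * (w (?i - n) + w (j - n)))
        * (norm (c j) * H (?i - j))"
      using exp_abs_diff_le[of \<mu> "real_of_int ?i" "real_of_int n" "real_of_int j"] m norm_le[of j x]
      by (intro mult_mono) (auto simp: w_def)
    also have "\<dots> = ?K (?i - j) * ?u j" by (simp add: algebra_simps)
    finally show ?thesis .
  qed
  moreover have "?u j \<le> B + B" "0 \<le> ?u j" for j
    using w(1) by (intro add_mono wB, simp)
  ultimately have "norm (\<Sum>\<^sub>\<infinity>j. ?D j) \<le> conv ?K ?u ?i"
    by (intro norm_infsum_le_conv(2)[where B = "B + B"] K0 K)
  also have "\<dots> = w (?i - n) * conv ?K (\<lambda>j. norm (c j)) ?i + conv ?K (\<lambda>j. w (j - n) * norm (c j)) ?i"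
    by (intro conv_add_cmult[where B = B and B' = B] K0 K) (use w(1) c wB in auto)
  also have "(\<Sum>\<^sub>\<infinity>j. ?D j) = synthesis \<phi> (\<lambda>j. of_real (w (j - n)) * c j) x - of_real (w (?i - n)) * synthesis \<phi> c x"
    using D by (rule infsumI)
  finally show ?thesis
    using norm_triangle_ineq2[of "synthesis \<phi> (\<lambda>j. of_real (w (j - n)) * c j) x"
        "of_real (w (?i - n)) * synthesis \<phi> c x"]
      w[of "?i - n"] by (simp add: norm_mult)
qed

section \<open>Transfer of the lower bound from p to q\<close>

lemma synthesis_lower_bound:
  assumes p: "1 \<le> p" and C: "0 < C"
    and st: "\<And>c. c \<in> lp_space p \<Longrightarrow> lp_norm p c \<le> C * Lp_norm p (synthesis \<phi> c)"
    and q: "1 \<le> q"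
  obtains D where "0 \<le> D" "\<And>c. c \<in> lp_space q \<Longrightarrow> lp_norm q c \<le> D * Lp_norm q (synthesis \<phi> c)"
proof -
  define S where "S = infsum H UNIV"
  have S0: "0 \<le> S" unfolding S_def by (intro infsum_nonneg H_nonneg)
  \<comment> \<open>Chosen so that the oscillation term contributes at most a quarter of the norm to
    be absorbed; \<open>S + 1\<close> avoids dividing by 0.\<close>
  define e where "e = 1 / (4 * C * (S + 1))"
  have e: "0 < e" "C * (e * S) \<le> 1 / 4"
    using C S0 by (auto simp: e_def divide_simps)
  obtain d where d: "0 < d" "d \<le> 1"
    and osc: "\<And>j x y. \<bar>y - x\<bar> \<le> d \<Longrightarrow> norm (\<phi> j y - \<phi> j x) \<le> e * H (\<lfloor>x\<rfloor> - j)"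
    using modulus[OF e(1)] by blast
  \<comment> \<open>The commutator kernel occurs twice in the final inequality and thus contributes
    another quarter.\<close>
  have "0 < 1 / (8 * C)" using C by simp
  then obtain \<mu> where m: "0 < \<mu>"
    and Ks: "(\<lambda>k. H k * (1 - exp (- \<mu> * \<bar>real_of_int k\<bar>))) summable_on UNIV"
    and Kl: "(\<Sum>\<^sub>\<infinity>k. H k * (1 - exp (- \<mu> * \<bar>real_of_int k\<bar>))) \<le> 1 / (8 * C)"
    using exp_commutator_kernel_small[OF H_nonneg H_summable] by blast
  define K where "K k = H k * (1 - exp (- \<mu> * \<bar>real_of_int k\<bar>))" for k :: int
  define w where "w k = exp (- \<mu> * \<bar>real_of_int k\<bar>)" for k :: int
  define \<kappa> where "\<kappa> = infsum K UNIV"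
  define W where "W = infsum w UNIV"
  have K0: "0 \<le> K k" for k using H_nonneg[of k] m by (auto simp: K_def)
  have K: "K summable_on UNIV" and \<kappa>: "C * \<kappa> \<le> 1 / 8"
    using Ks Kl C by (auto simp: K_def[abs_def] \<kappa>_def field_simps)
  have w0: "0 \<le> w k" and w1: "w k \<le> 1" and w_minus: "w (- k) = w k" and w_zero: "w 0 = 1" for k
    using m by (auto simp: w_def)
  have ws: "w summable_on UNIV" using summable_on_exp_abs[OF m] by (simp add: w_def[abs_def])
  have W0: "0 \<le> W" unfolding W_def by (intro infsum_nonneg w0)
  \<comment> \<open>A bounded sequence becomes summable under the weight, hence lies in every
    sequence space; evenness of \<open>w\<close> turns its sum into a convolution.\<close>
  have wsum: "lp_le p (\<lambda>i. w (i - n) * u i) (conv w u n)"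
    if "\<And>i. 0 \<le> u i" "\<And>i. u i \<le> B" for u n B
  proof -
    have hs: "((\<lambda>i. w (i - n) * u i) has_sum conv w u n) UNIV"
      using conv_has_sum(2)[where B = B, OF w0 ws that, where n = n] w_minus[of "_ - n"]
      by (simp add: algebra_simps)
    then show ?thesis
      using lp_le_l1[OF _ has_sum_imp_summable[OF hs] p] infsumI[OF hs] w0 that by simp
  qed
  \<comment> \<open>The two copies of \<open>g\<close> in \<open>G\<close> give the coefficient
    2CW/d = D/4, which becomes D/2 once half of \<open>b\<close> has been absorbed.\<close>
  define D where "D = 8 * C * W / d"
  show thesis
  proof (rule that[of D])
    show "0 \<le> D" using C W0 d by (simp add: D_def)
    fix c
    assume c: "c \<in> lp_space q"
    define u where "u j = norm (c j)" for j
    have cq: "lp_le q u (lp_norm q c)" using lp_le_lp_norm[OF c q] by (simp add: u_def[abs_def])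
    define B where "B = lp_norm q c"
    have u: "0 \<le> u j" "u j \<le> B" for j using lp_le_bound[OF cq q] by (auto simp: u_def B_def)
    have cB: "norm (c j) \<le> B" for j using u by (simp add: u_def)
    define F where "F = synthesis \<phi> c"
    have FL: "F \<in> Lp_space q" unfolding F_def by (rule synthesis_upper_bound[OF c q])
    have Fc: "continuous_on UNIV F" unfolding F_def by (rule continuous_synthesis[OF cB])
    define g where "g i = integral {real_of_int i..real_of_int i + 1} (\<lambda>x. norm (F x))" for i :: int
    have gq: "lp_le q g (Lp_norm q F)"
      using lp_le_unit_integrals[OF FL Fc q] by (simp add: g_def[abs_def])
    define G where "G i = (1 / d) * (g i + g (i + 1))" for i
    have Gq: "lp_le q G ((1 / d) * (Lp_norm q F + Lp_norm q F))"
      unfolding G_def[abs_def] using d by (intro lp_le_cmult lp_le_add gq lp_le_shift q) auto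
    note G = lp_le_nonneg'[OF Gq] lp_le_bound[OF Gq q]
    \<comment> \<open>Since \<open>c\<close> is bounded, these localizations around \<open>n\<close>
      belong to the space with exponent p even if \<open>c\<close> itself does not, so the assumed
      lower bound may be applied to them.\<close>
    define v where "v n j = of_real (w (j - n)) * c j" for n j
    have nv: "norm (v n j) = w (j - n) * u j" for n j
      using w0[of "j - n"] by (simp add: v_def u_def norm_mult)
    define \<beta> where "\<beta> n = lp_norm p (v n)" for n
    have vp: "v n \<in> lp_space p" and \<beta>_le: "\<beta> n \<le> conv w u n" for n
      using lp_norm_le[OF wsum[of u B n, OF u, folded nv] p] by (auto simp: \<beta>_def)
    have bp: "lp_le p (\<lambda>i. w (i - n) * u i) (\<beta> n)" for n
      using lp_le_lp_norm[OF vp p] by (simp add: \<beta>_def nv)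
    note \<beta>0 = lp_le_nonneg[OF bp]
    \<comment> \<open>The absorption below needs the \<open>\<ell>\<^sup>q\<close> norm of \<open>\<beta>\<close> to be finite.\<close>
    have \<beta>q': "lp_le q \<beta> (W * B)"
      by (rule lp_le_mono[OF lp_le_conv[OF cq w0 ws q] \<beta>0 \<beta>_le _ q]) (simp add: W_def B_def)
    \<comment> \<open>Absorption requires the least admissible bound on both sides, so the norm
      itself replaces \<open>W * B\<close>. The coercion is there because \<open>lp_norm\<close>
      takes complex sequences.\<close>
    define b where "b = lp_norm q (\<lambda>n. of_real (\<beta> n))"
    have norm_\<beta>: "norm (of_real (\<beta> n) :: complex) = \<beta> n" for n using \<beta>0 by simp
    have \<beta>q: "lp_le q \<beta> b"
      using lp_le_lp_norm[OF lp_norm_le(1)[of q "\<lambda>n. of_real (\<beta> n)" "W * B"] q] \<beta>q' q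
      unfolding b_def norm_\<beta> by simp
    have b_least: "b \<le> t" if "lp_le q \<beta> t" for t
      unfolding b_def by (rule lp_norm_le(2)) (use that q in \<open>simp_all only: norm_\<beta>\<close>)
    note \<beta>b = lp_le_bound[OF \<beta>q q]
    have step: "\<beta> n \<le> C * (conv w G n + e * conv H \<beta> n + (conv K \<beta> n + \<kappa> * \<beta> n))" for n
    proof -
      \<comment> \<open>Cellwise majorant of the synthesis of \<open>v n\<close>: local average,
        oscillation error, and the two commutator terms. In the bound \<open>U\<close>, the
        commutator term with the weight outside turns into \<open>conv K \<beta> n\<close>, the one
        with the weight inside into \<open>\<kappa> * \<beta> n\<close>.\<close>
      let ?U = "\<lambda>i. w (i - n) * G i + e * (w (i - n) * conv H u i)
        + (w (i - n) * conv K u i + conv K (\<lambda>j. w (j - n) * u j) i)"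
      have U: "lp_le p ?U (conv w G n + e * conv H \<beta> n + (conv K \<beta> n + \<kappa> * \<beta> n))"
        unfolding \<kappa>_def using e(1)
        by (intro lp_le_add p lp_le_cmult lp_le_weight_conv[where B = b] lp_le_conv wsum[of G, OF G] bp \<beta>b
            H_nonneg H_summable K0 K) auto
      have vB: "norm (v n j) \<le> B" for j
        unfolding nv using u[of j] w0[of "j - n"] w1[of "j - n"]
        by (intro order_trans[OF mult_left_le_one_le]) auto
      have "norm (synthesis \<phi> (v n) x) \<le> ?U \<lfloor>x\<rfloor>" for x
      proof -
        have "norm (synthesis \<phi> (v n) x) \<le> w (\<lfloor>x\<rfloor> - n) * norm (F x)
            + (w (\<lfloor>x\<rfloor> - n) * conv K u \<lfloor>x\<rfloor> + conv K (\<lambda>j. w (j - n) * u j) \<lfloor>x\<rfloor>)"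
          using synthesis_weighted_le[where c = c and n = n and x = x, OF cB m Ks]
          by (simp add: v_def[abs_def] w_def K_def[abs_def] u_def[abs_def] F_def)
        also have "norm (F x) \<le> G \<lfloor>x\<rfloor> + e * conv H u \<lfloor>x\<rfloor>"
          using synthesis_le_local_average[where c = c and x = x, OF cB less_imp_le[OF e(1)] d osc]
          by (simp add: F_def G_def g_def u_def[abs_def])
        finally show ?thesis using w0[of "\<lfloor>x\<rfloor> - n"] by (simp add: algebra_simps mult_right_mono)
      qed
      then have "Lp_norm p (synthesis \<phi> (v n)) \<le> conv w G n + e * conv H \<beta> n + (conv K \<beta> n + \<kappa> * \<beta> n)"
        by (intro Lp_norm_le(2)[OF _ _ U p] borel_measurable_continuous_onI continuous_synthesis[OF vB])
      then show ?thesis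
        using st[OF vp[of n]] C unfolding \<beta>_def
        by (meson mult_left_mono order_trans less_imp_le)
    qed
    \<comment> \<open>From here on only the exponent q occurs: Young's inequality is applied to each
      convolution in \<open>step\<close>.\<close>
    have "lp_le q (\<lambda>n. C * (conv w G n + e * conv H \<beta> n + (conv K \<beta> n + \<kappa> * \<beta> n)))
       (C * (W * ((1 / d) * (Lp_norm q F + Lp_norm q F)) + e * (S * b) + (\<kappa> * b + \<kappa> * b)))"
      unfolding W_def S_def \<kappa>_def using e(1) C
      by (intro lp_le_cmult lp_le_add lp_le_conv q Gq \<beta>q w0 ws H_nonneg H_summable K0 K infsum_nonneg) auto
    then have "lp_le q \<beta> (C * (W * ((1 / d) * (Lp_norm q F + Lp_norm q F)) + e * (S * b) + (\<kappa> * b + \<kappa> * b)))"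
      by (rule lp_le_mono[OF _ \<beta>0 step order_refl q])
    then have "b \<le> C * (W * ((1 / d) * (Lp_norm q F + Lp_norm q F)) + e * (S * b) + (\<kappa> * b + \<kappa> * b))"
      by (rule b_least)
    also have "\<dots> = D * Lp_norm q F / 4 + (C * (e * S)) * b + 2 * (C * \<kappa>) * b"
      by (simp add: D_def algebra_simps)
    also have "\<dots> \<le> D * Lp_norm q F / 4 + 1 / 4 * b + 2 * (1 / 8) * b"
      using e(2) \<kappa> lp_le_nonneg[OF \<beta>q] by (intro add_mono mult_right_mono mult_left_mono) auto
    finally have bD: "b \<le> D * Lp_norm q F / 2" by simp
    \<comment> \<open>The weight is 1 at its centre, so |c n| is an entry of the sequence whose norm
      is \<open>\<beta> n\<close>.\<close>
    have "u n \<le> \<beta> n" for n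
      using lp_le_bound[OF bp p, of n n] by (simp add: w_zero)
    then have "lp_le q (\<lambda>n. norm (c n)) b"
      using lp_le_mono[OF \<beta>q u(1) _ order_refl q] by (simp add: u_def)
    then have "lp_norm q c \<le> b" by (rule lp_norm_le(2)[OF _ q])
    also have "\<dots> \<le> D * Lp_norm q F"
      using bD lp_le_nonneg[OF \<beta>q] by simp
    finally show "lp_norm q c \<le> D * Lp_norm q (synthesis \<phi> c)" by (simp add: F_def)
  qed
qed

lemma lp_stable_transfer:
  assumes p: "1 \<le> p" and st: "lp_stable \<phi> p" and q: "1 \<le> q"
  shows "lp_stable \<phi> q"
proof -
  obtain C where C: "0 < C" "\<And>c. c \<in> lp_space p \<Longrightarrow> inverse C * lp_norm p c \<le> Lp_norm p (synthesis \<phi> c)"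
    using st unfolding lp_stable_def by blast
  have "lp_norm p c \<le> C * Lp_norm p (synthesis \<phi> c)" if "c \<in> lp_space p" for c
    using C(2)[OF that] C(1) by (simp add: field_simps)
  from synthesis_lower_bound[OF p C(1) this q] obtain D where D: "0 \<le> D"
    "\<And>c. c \<in> lp_space q \<Longrightarrow> lp_norm q c \<le> D * Lp_norm q (synthesis \<phi> c)" by blast
  \<comment> \<open>One constant dominating both the upper and the lower bound; the 1 keeps it
    positive.\<close>
  define E where "E = 1 + infsum H UNIV + D"
  have S0: "0 \<le> infsum H UNIV" by (intro infsum_nonneg H_nonneg)
  have E: "0 < E" using S0 D by (simp add: E_def)
  have "inverse E * lp_norm q c \<le> Lp_norm q (synthesis \<phi> c)"
    "Lp_norm q (synthesis \<phi> c) \<le> E * lp_norm q c" if c: "c \<in> lp_space q" for c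
  proof -
    have "0 \<le> lp_norm q c" by (rule lp_le_nonneg[OF lp_le_lp_norm[OF c q]])
    then show "Lp_norm q (synthesis \<phi> c) \<le> E * lp_norm q c"
      using D S0 by (intro order_trans[OF synthesis_upper_bound(2)[OF c q]] mult_right_mono) (auto simp: E_def)
    have "lp_norm q c \<le> E * Lp_norm q (synthesis \<phi> c)"
      using S0 by (intro order_trans[OF D(2)[OF c]] mult_right_mono) (auto simp: E_def Lp_norm_def)
    then show "inverse E * lp_norm q c \<le> Lp_norm q (synthesis \<phi> c)"
      using E by (simp add: field_simps)
  qed
  then show ?thesis
    unfolding lp_stable_def using E synthesis_upper_bound(1)[OF _ q] by blast
qed

end

section \<open>Reduction of the hypotheses to a summable majorant\<close>

lemma wiener_amalgam_majorant:
  fixes h :: "real \<Rightarrow> real"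
  assumes "h \<in> wiener_amalgam"
  obtains H :: "int \<Rightarrow> real" where "\<And>k. 0 \<le> H k" "H summable_on UNIV"
    "\<And>x j. \<bar>h (x - of_int j)\<bar> \<le> H (\<lfloor>x\<rfloor> - j)"
proof -
  define s where "s k = (SUP x\<in>{0..<1}. ennreal (norm (h (of_int k + x))))" for k :: int
  define T where "T = (\<Sum>\<^sub>\<infinity>k. s k)"
  have T: "T < \<infinity>" using assms by (simp add: wiener_amalgam_def wiener_norm_def T_def s_def)
  have sum_le: "sum s A \<le> T" if "finite A" for A
  proof -
    have "T = (SUP F\<in>{F. finite F \<and> F \<subseteq> UNIV}. sum s F)"
      unfolding T_def by (rule nonneg_infsum_complete) simp
    then show ?thesis using that by (auto intro: SUP_upper)
  qed
  \<comment> \<open>Finiteness matters because \<open>enn2real\<close> sends infinity to 0, and then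
    \<open>H k\<close> would no longer dominate h on its cell.\<close>
  have fin: "s k < \<infinity>" for k using sum_le[of "{k}"] T by auto
  define H where "H k = enn2real (s k)" for k
  have H0: "0 \<le> H k" for k by (simp add: H_def)
  have sH: "s k = ennreal (H k)" for k using fin[of k] by (simp add: H_def)
  show thesis
  proof (rule that[of H])
    show "0 \<le> H k" for k by (rule H0)
    show "H summable_on UNIV"
    proof (rule nonneg_bdd_above_summable_on)
      show "bdd_above (sum H ` {F. F \<subseteq> UNIV \<and> finite F})"
      proof (rule bdd_aboveI2)
        fix A assume "A \<in> {F :: int set. F \<subseteq> UNIV \<and> finite F}"
        then have "ennreal (sum H A) \<le> T"
          using sum_le[of A] by (simp add: sH H0 sum_ennreal)
        then show "sum H A \<le> enn2real T"
          using T by (metis ennreal_enn2real ennreal_le_iff enn2real_nonneg infinity_ennreal_def)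
      qed
    qed (rule H0)
    fix x and j :: int
    have "ennreal \<bar>h (x - of_int j)\<bar> \<le> s (\<lfloor>x\<rfloor> - j)"
      unfolding s_def
    \<comment> \<open>Subtracting an integer preserves the fractional part: x - j is the integer
      \<open>\<lfloor>x\<rfloor> - j\<close> plus \<open>frac x\<close>.\<close>
    proof (rule SUP_upper2[of "frac x"])
      show "frac x \<in> {0..<1}" by (simp add: frac_lt_1)
    qed (simp add: frac_def)
    then show "\<bar>h (x - of_int j)\<bar> \<le> H (\<lfloor>x\<rfloor> - j)" by (simp add: sH H0)
  qed
qed

theorem theorem1p3:
  fixes h :: "real \<Rightarrow> real" and \<omega> :: "real \<Rightarrow> real" and \<phi> :: "int \<Rightarrow> real \<Rightarrow> complex"
  assumes "continuous_on UNIV h"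
    and "h \<in> wiener_amalgam"
    and "\<And>\<delta>. \<delta> \<in> {0<..<1} \<Longrightarrow> \<omega> \<delta> > 0"
    and "mono_on {0<..<1} \<omega>"
    and "(\<omega> \<longlongrightarrow> 0) (at_right 0)"
    and "\<And>j x. norm (\<phi> j x) \<le> h (x - of_int j)"
    and "\<And>j x \<delta>. \<delta> \<in> {0<..<1} \<Longrightarrow>
           modulus_of_continuity \<delta> (\<phi> j) x \<le> ennreal (\<omega> \<delta> * h (x - of_int j))"
    and "\<exists>p\<ge>1. lp_stable \<phi> p"
  shows "\<forall>q\<ge>1. lp_stable \<phi> q"
proof -
  obtain H :: "int \<Rightarrow> real" where H: "\<And>k. 0 \<le> H k" "H summable_on UNIV"
    and hH: "\<And>x j. \<bar>h (x - of_int j)\<bar> \<le> H (\<lfloor>x\<rfloor> - j)"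
    using wiener_amalgam_majorant[OF assms(2)] by blast
  interpret localized_family \<phi> H
  proof
    show "norm (\<phi> j x) \<le> H (\<lfloor>x\<rfloor> - j)" for j x
      using assms(6)[of j x] hH[of x j] by linarith
    fix e :: real
    assume e: "0 < e"
    then have "\<forall>\<^sub>F \<delta> in at_right 0. \<omega> \<delta> < e \<and> \<delta> \<in> {0<..<1}"
      by (intro eventually_conj order_tendstoD(2)[OF assms(5)] eventually_at_right_real) auto
    then obtain \<delta> where \<delta>: "\<omega> \<delta> < e" "\<delta> \<in> {0<..<1}"
      using eventually_happens[of _ "at_right (0::real)"] by auto
    have "norm (\<phi> j y - \<phi> j x) \<le> e * H (\<lfloor>x\<rfloor> - j)" if "\<bar>y - x\<bar> \<le> \<delta>" for j x y
    proof -
      have "ennreal (norm (\<phi> j (x + (y - x)) - \<phi> j x)) \<le> modulus_of_continuity \<delta> (\<phi> j) x"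
        unfolding modulus_of_continuity_def by (rule SUP_upper) (use that in simp)
      also have "\<dots> \<le> ennreal (\<omega> \<delta> * h (x - of_int j))" by (rule assms(7)[OF \<delta>(2)])
      \<comment> \<open>The product bound uses that h is nonnegative at x - j, which holds because
        it dominates a norm there.\<close>
      also have "\<dots> \<le> ennreal (e * H (\<lfloor>x\<rfloor> - j))"
        using \<delta>(1) e hH[of x j] assms(6)[of j x] norm_ge_zero[of "\<phi> j x"] assms(3)[OF \<delta>(2)]
        by (intro ennreal_leI mult_mono) linarith+
      finally show ?thesis
        using e H(1) by (simp add: ennreal_le_iff)
    qed
    then show "\<exists>d>0. d \<le> 1 \<and> (\<forall>j x y. \<bar>y - x\<bar> \<le> d \<longrightarrow> norm (\<phi> j y - \<phi> j x) \<le> e * H (\<lfloor>x\<rfloor> - j))"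
      using \<delta>(2) by (intro exI[of _ \<delta>]) auto
  qed (rule H)+
  show ?thesis using assms(8) lp_stable_transfer by blast
qed

end
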